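(* For any abstract factorial $!_{a}$, the number $e_{a} = \sum_{n=0}^{\infty} \frac{1}{n!_{a}}$ is irrational. In fact, if $k \geq 1$, $!_{a_1}, !_{a_2}, \dots, !_{a_k}$ is any collection of abstract factorials, and $s_1, \dots, s_k \in \mathbb{N}$ are not all equal to zero, then $$\sum_{n=0}^{\infty} \frac{1}{\prod_{j=1}^{k} (n!_{a_j})^{s_j}}$$ is irrational.
   Context: $\mathbb{N}=\{0,1,2,\dots\}$ and $\mathbb{Z}^+=\{1,2,3,\dots\}$. An abstract factorial (also called a factorial function) is a function $!_{a}:\mathbb{N}\to\mathbb{Z}^+$, $n\mapsto n!_{a}$, such that: (1) $0!_{a}=1$; (2) for all integers $0\le k\le n$, the generalized binomial coefficient $\binom{n}{k}_{a}:=\frac{n!_{a}}{k!_{a}\,(n-k)!_{a}}$ is a positive integer; (3) for every positive integer $n$, the ordinary factorial $n!$ divides $n!_{a}$. *)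

theory Defs
  imports Complex_Main
begin

definition generalized_binomial :: "(nat \<Rightarrow> nat) \<Rightarrow> nat \<Rightarrow> nat \<Rightarrow> rat" where
  "generalized_binomial f n k = of_nat (f n) / (of_nat (f k) * of_nat (f (n - k)))"

(* The value of the generalized binomial coefficient is taken in the field rat, so that its
   being a positive integer is a genuine condition rather than an artefact of div on nat. *)
definition abstract_factorial :: "(nat \<Rightarrow> nat) \<Rightarrow> bool" where
  "abstract_factorial f \<longleftrightarrow>
     (\<forall>n. f n > 0) \<and>
     f 0 = 1 \<and>
     (\<forall>n. \<forall>k\<le>n. generalized_binomial f n k \<in> \<int> \<and> generalized_binomial f n k > 0) \<and>
     (\<forall>n>0. fact n dvd f n)"

end

(* Condition (2) says f m * f n dvd f (m + n), so weighted products of abstract factorials are again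
   abstract factorials, and one factorial f suffices.  If S = (\<Sum>n. 1 / f n) satisfied q * S = p with
   natural numbers p and q > 0, then q * f n * (\<Sum>m>n. 1 / f m) would be a positive integer for every n.
   But f (n + 1 + j) \<ge> f (n + 1) * f j bounds this number by p * f n / f (n + 1), which is below 1
   for some n, since otherwise n! \<le> f n \<le> p ^ n for all n. *)
theory Submission
  imports Defs
begin

text \<open>Clearing the nonzero denominator turns integrality of a quotient in \<open>rat\<close>
  into a divisibility in \<open>nat\<close>; the rest of the proof works with the latter.\<close>

lemma generalized_binomial_Ints_iff:
  assumes "f k > 0" "f (n - k) > 0"
  shows "generalized_binomial f n k \<in> \<int> \<longleftrightarrow> f k * f (n - k) dvd f n"
proof -
  let ?d = "f k * f (n - k)"
  have d: "(of_nat ?d :: rat) \<noteq> 0"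
    using assms by simp
  have "generalized_binomial f n k \<in> \<int> \<longleftrightarrow> (of_int (int (f n)) / of_int (int ?d) :: rat) \<in> \<int>"
    by (simp add: generalized_binomial_def)
  also have "\<dots> \<longleftrightarrow> int ?d dvd int (f n)"
  proof
    assume "(of_int (int (f n)) / of_int (int ?d) :: rat) \<in> \<int>"
    then obtain z where "(of_int (int (f n)) / of_int (int ?d) :: rat) = of_int z"
      by (elim Ints_cases)
    then have "(of_int (int (f n)) :: rat) = of_int (z * int ?d)"
      using d by (simp add: field_simps)
    then have "int (f n) = z * int ?d"
      by (simp only: of_int_eq_iff)
    then show "int ?d dvd int (f n)"
      by simp
  qed (rule of_int_divide_in_Ints)
  also have "\<dots> \<longleftrightarrow> ?d dvd f n"
    by (simp only: int_dvd_int_iff)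
  finally show ?thesis .
qed

text \<open>A quotient of positive numbers is positive, so condition (2) reduces to divisibility;
  replacing \<open>n\<close> by \<open>k + (n - k)\<close> removes the subtraction and the side
  condition.\<close>

lemma abstract_factorial_iff:
  "abstract_factorial f \<longleftrightarrow>
     (\<forall>n. f n > 0) \<and> f 0 = 1 \<and> (\<forall>m n. f m * f n dvd f (m + n)) \<and> (\<forall>n>0. fact n dvd f n)"
proof -
  have "(\<forall>n. \<forall>k\<le>n. generalized_binomial f n k \<in> \<int> \<and> generalized_binomial f n k > 0)
        \<longleftrightarrow> (\<forall>m n. f m * f n dvd f (m + n))" if pos: "\<forall>n. f n > 0"
  proof -
    have "generalized_binomial f n k > 0" for n k
      using pos by (simp add: generalized_binomial_def)
    moreover have "(\<forall>n. \<forall>k\<le>n. f k * f (n - k) dvd f n) \<longleftrightarrow> (\<forall>m n. f m * f n dvd f (m + n))"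
      by (metis add_diff_cancel_left' le_add1 le_add_diff_inverse)
    ultimately show ?thesis
      using pos by (simp add: generalized_binomial_Ints_iff)
  qed
  then show ?thesis
    unfolding abstract_factorial_def by blast
qed

text \<open>Conditions (1) and (2) survive powers and products. For (3), one factor with nonzero
  exponent supplies the divisor \<open>fact n\<close>; with all exponents zero the product would be
  constantly 1 and (3) would fail.\<close>

lemma abstract_factorial_prod_power:
  assumes "finite J" and fac: "\<And>j. j \<in> J \<Longrightarrow> abstract_factorial (a j)" and "\<exists>j\<in>J. s j \<noteq> 0"
  shows "abstract_factorial (\<lambda>n. \<Prod>j\<in>J. a j n ^ s j)"
  unfolding abstract_factorial_iff
proof (intro conjI allI impI)
  note fac' = fac[unfolded abstract_factorial_iff]
  fix m n :: nat
  show "(\<Prod>j\<in>J. a j n ^ s j) > 0"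
    using fac' by (intro prod_pos) auto
  show "(\<Prod>j\<in>J. a j 0 ^ s j) = 1"
    using fac' by simp
  have "(\<Prod>j\<in>J. (a j m * a j n) ^ s j) dvd (\<Prod>j\<in>J. a j (m + n) ^ s j)"
    using fac' by (intro prod_dvd_prod dvd_power_same) auto
  then show "(\<Prod>j\<in>J. a j m ^ s j) * (\<Prod>j\<in>J. a j n ^ s j) dvd (\<Prod>j\<in>J. a j (m + n) ^ s j)"
    by (simp add: power_mult_distrib prod.distrib)
  assume "n > 0"
  obtain i where i: "i \<in> J" "s i \<noteq> 0"
    using assms(3) by blast
  have "fact n dvd a i n"
    using fac' i \<open>n > 0\<close> by blast
  also have "\<dots> dvd a i n ^ s i"
    using i by (intro dvd_power) auto
  also have "\<dots> dvd (\<Prod>j\<in>J. a j n ^ s j)"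
    using i \<open>finite J\<close> by (intro dvd_prodI)
  finally show "fact n dvd (\<Prod>j\<in>J. a j n ^ s j)" .
qed

context
  fixes f :: "nat \<Rightarrow> nat"
  assumes f: "abstract_factorial f"
begin

lemma abstract_factorial_pos: "f n > 0"
  using f by (simp add: abstract_factorial_iff)

lemma abstract_factorial_mult_dvd: "f m * f n dvd f (m + n)"
  using f by (simp add: abstract_factorial_iff)

lemma abstract_factorial_mult_le: "f m * f n \<le> f (m + n)"
  by (intro dvd_imp_le abstract_factorial_mult_dvd abstract_factorial_pos)

lemma abstract_factorial_dvd:
  assumes "m \<le> n"
  shows "f m dvd f n"
  using abstract_factorial_mult_dvd[of m "n - m"] assms by (auto dest: dvd_mult_left)

lemma fact_le_abstract_factorial: "fact n \<le> f n"
proof (cases "n = 0")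
  case False
  then have "fact n dvd f n"
    using f by (simp add: abstract_factorial_iff)
  then show ?thesis
    by (rule dvd_imp_le) (rule abstract_factorial_pos)
qed (use f in \<open>simp add: abstract_factorial_iff\<close>)

text \<open>Since \<open>fact n \<le> f n\<close>, the series is dominated by the exponential series
  at 1.\<close>

lemma summable_inverse_abstract_factorial: "summable (\<lambda>n. 1 / real (f n))"
proof (rule summable_comparison_test')
  show "summable (\<lambda>n. inverse (fact n) * (1::real) ^ n)"
    by (rule summable_exp)
  fix n
  have "real (fact n) \<le> real (f n)"
    using fact_le_abstract_factorial by (simp only: of_nat_le_iff)
  then show "norm (1 / real (f n)) \<le> inverse (fact n) * 1 ^ n"
    using abstract_factorial_pos[of n] by (simp add: field_simps)
qed

lemma abstract_factorial_ratio_unbounded: "\<exists>n. p * f n < f (Suc n)"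
proof (rule ccontr)
  assume "\<nexists>n. p * f n < f (Suc n)"
  then have step: "f (Suc n) \<le> p * f n" for n
    by (simp add: not_less)
  have "f n \<le> p ^ n" for n
  proof (induction n)
    case 0
    then show ?case
      using f by (simp add: abstract_factorial_iff)
  next
    case (Suc n)
    then show ?case
      using order_trans[OF step[of n] mult_le_mono2] by simp
  qed
  then have "real (fact n) \<le> real (p ^ n)" for n
    using fact_le_abstract_factorial order_trans of_nat_le_iff by blast
  then have "1 \<le> inverse (fact n) * real p ^ n" for n
    by (simp add: field_simps)
  \<comment> \<open>These are the terms of the convergent exponential series at \<open>p\<close>, so
    they cannot all be at least 1.\<close>
  moreover have "(\<lambda>n. inverse (fact n) * real p ^ n) \<longlonglongrightarrow> 0"
    by (intro summable_LIMSEQ_zero summable_exp)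
  ultimately have "(1::real) \<le> 0"
    by (intro LIMSEQ_le_const) auto
  then show False
    by simp
qed

lemma suminf_inverse_abstract_factorial_irrational: "(\<Sum>n. 1 / real (f n)) \<notin> \<rat>"
proof
  let ?g = "\<lambda>n. 1 / real (f n)"
  let ?S = "\<Sum>n. ?g n"
  note summ = summable_inverse_abstract_factorial
  note pos = abstract_factorial_pos
  assume "?S \<in> \<rat>"
  moreover have "?S > 0"
    by (intro suminf_pos summ) (simp add: pos)
  ultimately obtain p q :: nat where pq: "q \<noteq> 0" "\<bar>?S\<bar> = real p / real q"
    by (auto elim: Rats_abs_nat_div_natE)
  have S: "real q * ?S = real p"
    using pq \<open>?S > 0\<close> by (simp add: field_simps)
  \<comment> \<open>The multiplier is the numerator \<open>p\<close> because the tail estimate below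
    produces the factor \<open>q * ?S\<close>, which equals \<open>p\<close>.\<close>
  obtain n where n: "p * f n < f (Suc n)"
    using abstract_factorial_ratio_unbounded by blast
  define T where "T = (\<Sum>j. ?g (j + Suc n))"
  have summT: "summable (\<lambda>j. ?g (j + Suc n))"
    by (rule summable_ignore_initial_segment[OF summ])
  have split: "?S = T + (\<Sum>m<Suc n. ?g m)"
    unfolding T_def by (rule suminf_split_initial_segment[OF summ])
  have "T > 0"
    unfolding T_def by (intro suminf_pos summT) (simp add: pos)
  have "T \<le> (\<Sum>j. ?g (Suc n) * ?g j)"
    unfolding T_def
  proof (intro suminf_le summT summable_mult summ)
    fix j
    \<comment> \<open>Supermultiplicativity bounds the tail termwise by the whole series scaled by
      \<open>1 / f (Suc n)\<close>.\<close>
    have "real (f j * f (Suc n)) \<le> real (f (j + Suc n))"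
      using abstract_factorial_mult_le by (simp only: of_nat_le_iff)
    then show "?g (j + Suc n) \<le> ?g (Suc n) * ?g j"
      using pos[of j] pos[of "Suc n"] pos[of "j + Suc n"]
      by (simp add: field_simps del: add_Suc_right)
  qed
  also have "\<dots> = ?g (Suc n) * ?S"
    by (rule suminf_mult[OF summ])
  finally have "real q * real (f n) * T \<le> real q * real (f n) * (?g (Suc n) * ?S)"
    by (rule mult_left_mono) simp
  also have "\<dots> = real (f n) * ?g (Suc n) * (real q * ?S)"
    by (simp only: mult_ac)
  also have "\<dots> = real (p * f n) / real (f (Suc n))"
    by (simp add: S mult.commute)
  also have "\<dots> < 1"
    using n pos[of "Suc n"] by (simp del: of_nat_mult)
  finally have "real q * real (f n) * T < 1" .
  moreover have "real q * real (f n) * T > 0"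
    using pq pos[of n] \<open>T > 0\<close> by simp
  \<comment> \<open>Write \<open>T\<close> as \<open>?S\<close> minus the terms up to index
    \<open>n\<close>: \<open>q\<close> clears the denominator of \<open>?S\<close>, and
    \<open>f n\<close> clears those of the terms, as \<open>f m dvd f n\<close> for
    \<open>m \<le> n\<close>.\<close>
  moreover have "real q * real (f n) * T \<in> \<int>"
  proof -
    have "real (f n) * ?g m \<in> \<int>" if "m < Suc n" for m
    proof -
      have "real (f n) / real (f m) = real (f n div f m)"
        using that by (intro real_of_nat_div[symmetric] abstract_factorial_dvd) simp
      then show ?thesis
        by simp
    qed
    then have "real q * (\<Sum>m<Suc n. real (f n) * ?g m) \<in> \<int>"
      by (rule Ints_mult[OF Ints_of_nat Ints_sum]) (simp only: lessThan_iff)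
    moreover have "real q * real (f n) * T =
        real (f n) * (real q * ?S) - real q * (\<Sum>m<Suc n. real (f n) * ?g m)"
      unfolding split sum_distrib_left[symmetric] by (simp only: algebra_simps)
    ultimately show ?thesis
      by (simp only: S) (rule Ints_diff[OF Ints_mult[OF Ints_of_nat Ints_of_nat]])
  qed
  \<comment> \<open>No integer lies strictly between 0 and 1.\<close>
  ultimately show False
    by (auto elim!: Ints_cases)
qed

end

theorem theorem28:
  shows "(\<forall>f. abstract_factorial f \<longrightarrow>
            summable (\<lambda>n. 1 / real (f n)) \<and> (\<Sum>n. 1 / real (f n)) \<notin> \<rat>) \<and>
         (\<forall>(k::nat) (a :: nat \<Rightarrow> nat \<Rightarrow> nat) (s :: nat \<Rightarrow> nat).
            k \<ge> 1 \<longrightarrow>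
            (\<forall>j\<in>{1..k}. abstract_factorial (a j)) \<longrightarrow>
            (\<exists>j\<in>{1..k}. s j \<noteq> 0) \<longrightarrow>
            summable (\<lambda>n. 1 / (\<Prod>j=1..k. real (a j n) ^ s j)) \<and>
            (\<Sum>n. 1 / (\<Prod>j=1..k. real (a j n) ^ s j)) \<notin> \<rat>)"
\<comment> \<open>The pattern given to \<open>conjI\<close> fits only the outer conjunction, so
  summability and irrationality stay together in each half.\<close>
proof (intro conjI[of "\<forall>f. _ f"] allI impI)
  fix f
  assume "abstract_factorial f"
  then show "summable (\<lambda>n. 1 / real (f n)) \<and> (\<Sum>n. 1 / real (f n)) \<notin> \<rat>"
    using summable_inverse_abstract_factorial suminf_inverse_abstract_factorial_irrational by blast
next
  fix k :: nat and a :: "nat \<Rightarrow> nat \<Rightarrow> nat" and s :: "nat \<Rightarrow> nat"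
  assume "\<forall>j\<in>{1..k}. abstract_factorial (a j)" and "\<exists>j\<in>{1..k}. s j \<noteq> 0"
  then have "abstract_factorial (\<lambda>n. \<Prod>j=1..k. a j n ^ s j)"
    by (intro abstract_factorial_prod_power) auto
  from summable_inverse_abstract_factorial[OF this]
    suminf_inverse_abstract_factorial_irrational[OF this]
  show "summable (\<lambda>n. 1 / (\<Prod>j=1..k. real (a j n) ^ s j)) \<and>
        (\<Sum>n. 1 / (\<Prod>j=1..k. real (a j n) ^ s j)) \<notin> \<rat>"
    by simp
qed

end
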